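(* Let $0<q<p$ be real and let $a$ be a real number. For every $s>0$ with $s>\left|\frac aq\right|$, $$\mathcal L_{p,q}\{\mathrm{Cos}_{p,q}(at)\}(s)=\frac{q^2s}{(qs)^2+a^2},\qquad \mathcal L_{p,q}\{\mathrm{Sin}_{p,q}(at)\}(s)=\frac{qa}{(qs)^2+a^2}.$$
   Context: Let $0<q<p$ be real numbers. For an integer $n\ge 0$, $[n]_{p,q}=\frac{p^n-q^n}{p-q}$, $[n]_{p,q}!=\prod_{k=1}^n[k]_{p,q}$, $[0]_{p,q}!=1$. The $(p,q)$-exponentials are $E_{p,q}(z)=\sum_{n\ge0}\frac{q^{\binom n2}}{[n]_{p,q}!}z^n$ (entire) and $e_{p,q}(z)=\sum_{n\ge0}\frac{p^{\binom n2}}{[n]_{p,q}!}z^n$; the latter series converges for $|z|<p/(p-q)$ and $e_{p,q}$ is extended meromorphically to $\mathbb C$ by $e_{p,q}(z)=1/E_{p,q}(-z)$. The big $(p,q)$-cosine and sine are $\mathrm{Cos}_{p,q}(z)=\sum_{n\ge0}\frac{(-1)^nq^{\binom{2n}2}}{[2n]_{p,q}!}z^{2n}$ and $\mathrm{Sin}_{p,q}(z)=\sum_{n\ge0}\frac{(-1)^nq^{\binom{2n+1}2}}{[2n+1]_{p,q}!}z^{2n+1}$. The improper $(p,q)$-integral of $f$ is $\int_0^\infty f(x)\,d_{p,q}x=(p-q)\sum_{j=-\infty}^{\infty}\frac{q^j}{p^{j+1}}f\!\left(\frac{q^j}{p^{j+1}}\right)$; it converges if both the sum over $j\ge0$ and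 the sum over $j<0$ converge. The $(p,q)$-Laplace transform of the second kind is $\mathcal L_{p,q}\{f(t)\}(s)=\int_0^\infty f(t)e_{p,q}(-pts)\,d_{p,q}t$, $s>0$. *)

theory Defs
  imports "HOL-Analysis.Analysis"
begin

definition pq_number :: "real \<Rightarrow> real \<Rightarrow> nat \<Rightarrow> real" where
  "pq_number p q n = (p ^ n - q ^ n) / (p - q)"

definition pq_fact :: "real \<Rightarrow> real \<Rightarrow> nat \<Rightarrow> real" where
  "pq_fact p q n = (\<Prod>k=1..n. pq_number p q k)"

definition pq_Exp :: "real \<Rightarrow> real \<Rightarrow> complex \<Rightarrow> complex" where
  "pq_Exp p q z = (\<Sum>n. of_real (q ^ (n choose 2) / pq_fact p q n) * z ^ n)"

text \<open>The power series of the small exponential has radius of convergence p / (p - q); outside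
  that disk the function is its meromorphic continuation 1 / E(-z). At a pole, HOL division gives the
  value 0; the poles are the points z with E(-z) = 0, and E has only negative real zeros.\<close>

definition pq_exp :: "real \<Rightarrow> real \<Rightarrow> complex \<Rightarrow> complex" where
  "pq_exp p q z =
     (if norm z < p / (p - q)
      then (\<Sum>n. of_real (p ^ (n choose 2) / pq_fact p q n) * z ^ n)
      else 1 / pq_Exp p q (- z))"

definition pq_Cos :: "real \<Rightarrow> real \<Rightarrow> complex \<Rightarrow> complex" where
  "pq_Cos p q z =
     (\<Sum>n. of_real ((-1) ^ n * q ^ ((2 * n) choose 2) / pq_fact p q (2 * n)) * z ^ (2 * n))"

definition pq_Sin :: "real \<Rightarrow> real \<Rightarrow> complex \<Rightarrow> complex" where
  "pq_Sin p q z =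
     (\<Sum>n. of_real ((-1) ^ n * q ^ ((2 * n + 1) choose 2) / pq_fact p q (2 * n + 1)) * z ^ (2 * n + 1))"

definition pq_node :: "real \<Rightarrow> real \<Rightarrow> int \<Rightarrow> real" where
  "pq_node p q j = q powi j / p powi (j + 1)"

definition pq_term :: "real \<Rightarrow> real \<Rightarrow> (real \<Rightarrow> complex) \<Rightarrow> int \<Rightarrow> complex" where
  "pq_term p q f j = of_real (pq_node p q j) * f (pq_node p q j)"

text \<open>The bilateral sum is split into the indices j = n and j = -n - 1 with n a natural
  number; both halves are ordinary (possibly only conditionally convergent) series.\<close>

definition pq_integrable :: "real \<Rightarrow> real \<Rightarrow> (real \<Rightarrow> complex) \<Rightarrow> bool" where
  "pq_integrable p q f \<longleftrightarrow>
     summable (\<lambda>n. pq_term p q f (int n)) \<and> summable (\<lambda>n. pq_term p q f (- int n - 1))"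

definition pq_integral :: "real \<Rightarrow> real \<Rightarrow> (real \<Rightarrow> complex) \<Rightarrow> complex" where
  "pq_integral p q f =
     of_real (p - q) * ((\<Sum>n. pq_term p q f (int n)) + (\<Sum>n. pq_term p q f (- int n - 1)))"

definition pq_laplace_integrand ::
    "real \<Rightarrow> real \<Rightarrow> (real \<Rightarrow> complex) \<Rightarrow> real \<Rightarrow> real \<Rightarrow> complex" where
  "pq_laplace_integrand p q f s t = f t * pq_exp p q (of_real (- p * t * s))"

definition pq_laplace_converges :: "real \<Rightarrow> real \<Rightarrow> (real \<Rightarrow> complex) \<Rightarrow> real \<Rightarrow> bool" where
  "pq_laplace_converges p q f s \<longleftrightarrow> pq_integrable p q (pq_laplace_integrand p q f s)"

definition pq_laplace :: "real \<Rightarrow> real \<Rightarrow> (real \<Rightarrow> complex) \<Rightarrow> real \<Rightarrow> complex" where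
  "pq_laplace p q f s = pq_integral p q (pq_laplace_integrand p q f s)"

end

(* The two exponentials satisfy E(z) = (1 + (1 - r) z) E(r z) and e(r z) = (1 - (1 - r) z) e(z) with
   r = q / p, whence e(z) E(-z) = 1.  Therefore W(t) = E(b t) / E(q s t) satisfies
     (p - q) t E(b t) e(-p s t) = q / (q s - b) * (W(t) - W(t / r)),
   so the bilateral sum for the Laplace transform of t \<mapsto> E(b t) telescopes.  As W tends to 1 along
   the nodes tending to 0 and, for |b| < q s, to 0 along those tending to infinity, the transform is
   q / (q s - b).  Cos and Sin are combinations of the cases b = i a and b = - i a. *)

theory Submission
  imports Defs
begin

section \<open>Coefficients of the exponential series and the ratio test\<close>

lemma pq_number_pos:
  assumes "0 < q" "q < p" "0 < n"
  shows "pq_number p q n > 0"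
  using assms by (simp add: pq_number_def power_strict_mono)

lemma pq_fact_0 [simp]: "pq_fact p q 0 = 1"
  by (simp add: pq_fact_def)

lemma pq_fact_Suc: "pq_fact p q (Suc n) = pq_fact p q n * pq_number p q (Suc n)"
  by (simp add: pq_fact_def)

lemma pq_fact_pos:
  assumes "0 < q" "q < p"
  shows "pq_fact p q n > 0"
  using assms by (induction n) (auto simp: pq_fact_Suc intro!: mult_pos_pos pq_number_pos)

lemma Suc_choose_2: "Suc n choose 2 = n + (n choose 2)"
  by (simp add: numeral_2_eq_2)

text \<open>Coefficient form of the difference \<open>f(z) - f(r z)\<close> with
  \<open>r = q / p\<close>. The number \<open>p^(n+1) - q^(n+1)\<close> is both \<open>p - q\<close>
  times the last factor of the factorial and \<open>p^(n+1)\<close> times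
  \<open>1 - r^(n+1)\<close>, so it cancels; the binomial exponent grows by \<open>n\<close>, which
  leaves \<open>(x / p)^n\<close>.\<close>

lemma pq_coeff_step:
  assumes "0 < q" "q < p"
  shows "x ^ (Suc n choose 2) / pq_fact p q (Suc n) * (1 - (q / p) ^ Suc n)
       = x ^ (n choose 2) / pq_fact p q n * (x / p) ^ n * (1 - q / p)"
proof -
  have ne: "p ^ Suc n - q ^ Suc n \<noteq> 0"
    using power_strict_mono[OF assms(2), of "Suc n"] assms by auto
  have F: "pq_fact p q n \<noteq> 0" using pq_fact_pos[OF assms] by (metis less_irrefl)
  have eq: "1 - (q / p) ^ Suc n = (p ^ Suc n - q ^ Suc n) / p ^ Suc n" "1 - q / p = (p - q) / p"
    using assms by (simp_all add: power_divide diff_divide_distrib)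
  show ?thesis
    unfolding eq pq_fact_Suc pq_number_def Suc_choose_2 power_add power_divide
    using assms ne F by (simp add: divide_simps del: power_Suc) (simp add: mult_ac)
qed

lemma pq_coeff_ratio:
  assumes "0 < q" "q < p"
  shows "x ^ (Suc n choose 2) / pq_fact p q (Suc n)
       = x ^ (n choose 2) / pq_fact p q n * ((x / p) ^ n * (1 - q / p) / (1 - (q / p) ^ Suc n))"
proof -
  have "(q / p) ^ Suc n < 1" using assms by (intro power_Suc_less_one) auto
  then obtain D where D: "1 - (q / p) ^ Suc n = D" "D \<noteq> 0" by (metis diff_gt_0_iff_gt less_irrefl)
  have "a = b * (c * e / D)" if "a * D = b * c * e" for a b c e :: real
    using that D(2) by (simp add: eq_divide_eq mult_ac)
  thus ?thesis using pq_coeff_step[OF assms, of x n] unfolding D(1) .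
qed

text \<open>With x = q this is the series of E, with x = p the series of e; in the second case
  \<open>L = 1\<close>.\<close>

lemma summable_pq_series:
  fixes z :: complex
  assumes "0 < q" "q < p" and x: "(\<lambda>n. (x / p) ^ n) \<longlonglongrightarrow> L" "L * (1 - q / p) * norm z < 1" "0 < x"
  shows "summable (\<lambda>n. of_real (x ^ (n choose 2) / pq_fact p q n) * z ^ n)"
proof -
  \<comment> \<open>\<open>R n\<close> is the exact quotient of the norms of consecutive terms. Its
    limit is \<open>L * (1 - q / p) * norm z\<close>, and any \<open>c\<close> strictly between this
    limit and 1 serves the ratio test.\<close>
  define R where "R n = (x / p) ^ n * (1 - q / p) / (1 - (q / p) ^ Suc n) * norm z" for n
  have "(\<lambda>n. (q / p) ^ Suc n) \<longlonglongrightarrow> 0"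
    using assms by (intro LIMSEQ_Suc LIMSEQ_realpow_zero) auto
  hence "R \<longlonglongrightarrow> L * (1 - q / p) / (1 - 0) * norm z"
    unfolding R_def by (intro tendsto_intros x(1)) auto
  moreover obtain c where c: "L * (1 - q / p) * norm z < c" "c < 1"
    using dense[OF x(2)] by blast
  ultimately have "eventually (\<lambda>n. R n < c) sequentially"
    by (simp add: order_tendsto_iff)
  then obtain N where N: "\<And>n. n \<ge> N \<Longrightarrow> R n < c" by (auto simp: eventually_sequentially)
  have R0: "R n \<ge> 0" for n
    unfolding R_def using assms power_Suc_less_one[of "q / p" n] by auto
  show ?thesis
  proof (rule summable_ratio_test[OF c(2)])
    fix n assume "N \<le> n"
    hence "R n \<le> c" using N less_imp_le by blast
    let ?f = "\<lambda>n. of_real (x ^ (n choose 2) / pq_fact p q n) * z ^ n"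
    have "norm (?f (Suc n)) = R n * norm (?f n)"
    proof -
      have "?f (Suc n) = of_real ((x / p) ^ n * (1 - q / p) / (1 - (q / p) ^ Suc n)) * z * ?f n"
        by (subst pq_coeff_ratio[OF assms(1,2)]) (simp add: mult_ac)
      moreover have "norm (of_real ((x / p) ^ n * (1 - q / p) / (1 - (q / p) ^ Suc n)) * z) = R n"
        using R0[of n] power_Suc_less_one[of "q / p" n] assms
        unfolding R_def norm_mult norm_of_real by (subst abs_of_nonneg) auto
      ultimately show ?thesis by (simp only: norm_mult)
    qed
    also have "\<dots> \<le> c * norm (?f n)" using \<open>R n \<le> c\<close> by (intro mult_right_mono) auto
    finally show "norm (?f (Suc n)) \<le> c * norm (?f n)" .
  qed
qed

section \<open>The two exponentials and their behaviour under scaling by q / p\<close>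

lemma summable_pq_Exp:
  assumes "0 < q" "q < p"
  shows "summable (\<lambda>n. of_real (q ^ (n choose 2) / pq_fact p q n) * z ^ n :: complex)"
  \<comment> \<open>For \<open>x = q\<close> the powers \<open>(q / p)^n\<close> tend to 0, so the
    ratio condition holds for every \<open>z\<close>.\<close>
  using assms by (intro summable_pq_series[where L = 0] LIMSEQ_realpow_zero) auto

text \<open>The power series branch of \<open>pq_exp\<close>, free of the case distinction, so that
  it can be manipulated termwise inside the disk.\<close>

definition pq_exp_series :: "real \<Rightarrow> real \<Rightarrow> complex \<Rightarrow> complex" where
  "pq_exp_series p q z = (\<Sum>n. of_real (p ^ (n choose 2) / pq_fact p q n) * z ^ n)"

lemma summable_pq_exp:
  assumes "0 < q" "q < p" "norm z < p / (p - q)"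
  shows "summable (\<lambda>n. of_real (p ^ (n choose 2) / pq_fact p q n) * z ^ n :: complex)"
  using assms by (intro summable_pq_series[where L = 1]) (auto simp: field_simps)

text \<open>In \<open>E(z) - E(r z)\<close> the constant terms cancel. After an index shift,
  \<open>pq_coeff_step\<close> with \<open>x = q\<close> supplies a factor \<open>r^n\<close>, which
  turns \<open>z^n\<close> into \<open>(r z)^n\<close>; hence the series at \<open>r z\<close>
  reappears.\<close>

lemma pq_Exp_functional:
  assumes "0 < q" "q < p"
  shows "pq_Exp p q z = (1 + of_real (1 - q / p) * z) * pq_Exp p q (of_real (q / p) * z)"
proof -
  define r where "r = q / p"
  let ?c = "\<lambda>n. of_real (q ^ (n choose 2) / pq_fact p q n) :: complex"
  note S = summable_pq_Exp[OF assms]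
  have "pq_Exp p q z - pq_Exp p q (of_real r * z) = (\<Sum>n. ?c n * z ^ n - ?c n * (of_real r * z) ^ n)"
    unfolding pq_Exp_def by (rule suminf_diff[OF S S])
  also have "\<dots> = (\<Sum>n. ?c (Suc n) * z ^ Suc n - ?c (Suc n) * (of_real r * z) ^ Suc n)"
    by (subst suminf_split_head[OF summable_diff[OF S S]]) simp
  also have "\<dots> = (\<Sum>n. of_real (1 - r) * z * (?c n * (of_real r * z) ^ n))"
  proof (rule suminf_cong)
    fix n
    have "?c (Suc n) * z ^ Suc n - ?c (Suc n) * (of_real r * z) ^ Suc n
        = of_real (q ^ (Suc n choose 2) / pq_fact p q (Suc n) * (1 - r ^ Suc n)) * z ^ Suc n"
      unfolding of_real_mult of_real_diff of_real_power power_mult_distrib of_real_1 by algebra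
    also have "\<dots> = of_real (1 - r) * z * (?c n * (of_real r * z) ^ n)"
      unfolding r_def pq_coeff_step[OF assms] by (simp add: power_mult_distrib power_divide)
    finally show "?c (Suc n) * z ^ Suc n - ?c (Suc n) * (of_real r * z) ^ Suc n
        = of_real (1 - r) * z * (?c n * (of_real r * z) ^ n)" .
  qed
  also have "\<dots> = of_real (1 - r) * z * pq_Exp p q (of_real r * z)"
    unfolding pq_Exp_def by (rule suminf_mult[OF S])
  finally show ?thesis by (simp add: r_def algebra_simps)
qed

text \<open>The same comparison with \<open>x = p\<close>: now \<open>(x / p)^n = 1\<close>, so the
  series reappears at \<open>z\<close> itself and the linear factor moves to the other side of the
  equation.\<close>

lemma pq_exp_series_functional:
  assumes "0 < q" "q < p" "norm z < p / (p - q)"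
  shows "pq_exp_series p q (of_real (q / p) * z) = (1 - of_real (1 - q / p) * z) * pq_exp_series p q z"
proof -
  define r where "r = q / p"
  let ?c = "\<lambda>n. of_real (p ^ (n choose 2) / pq_fact p q n) :: complex"
  have "norm (of_real r * z) \<le> norm z"
    unfolding norm_mult norm_of_real using assms by (intro mult_left_le_one_le) (auto simp: r_def)
  hence S: "summable (\<lambda>n. ?c n * z ^ n)" "summable (\<lambda>n. ?c n * (of_real r * z) ^ n)"
    using assms by (auto intro!: summable_pq_exp simp del: of_real_divide)
  have "pq_exp_series p q z - pq_exp_series p q (of_real r * z)
      = (\<Sum>n. ?c n * z ^ n - ?c n * (of_real r * z) ^ n)"
    unfolding pq_exp_series_def by (rule suminf_diff[OF S])
  also have "\<dots> = (\<Sum>n. ?c (Suc n) * z ^ Suc n - ?c (Suc n) * (of_real r * z) ^ Suc n)"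
    by (subst suminf_split_head[OF summable_diff[OF S]]) simp
  also have "\<dots> = (\<Sum>n. of_real (1 - r) * z * (?c n * z ^ n))"
  proof (rule suminf_cong)
    fix n
    have "?c (Suc n) * z ^ Suc n - ?c (Suc n) * (of_real r * z) ^ Suc n
        = of_real (p ^ (Suc n choose 2) / pq_fact p q (Suc n) * (1 - r ^ Suc n)) * z ^ Suc n"
      unfolding of_real_mult of_real_diff of_real_power power_mult_distrib of_real_1 by algebra
    also have "\<dots> = of_real (1 - r) * z * (?c n * z ^ n)"
      unfolding r_def pq_coeff_step[OF assms(1,2)] using assms by simp
    finally show "?c (Suc n) * z ^ Suc n - ?c (Suc n) * (of_real r * z) ^ Suc n
        = of_real (1 - r) * z * (?c n * z ^ n)" .
  qed
  also have "\<dots> = of_real (1 - r) * z * pq_exp_series p q z"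
    unfolding pq_exp_series_def by (rule suminf_mult[OF S(1)])
  finally show ?thesis by (simp add: r_def algebra_simps)
qed

section \<open>Behaviour at 0 and reciprocity of the two exponentials\<close>

lemma pq_Exp_0 [simp]: "pq_Exp p q 0 = 1"
  using powser_sums_zero[of "\<lambda>n. of_real (q ^ (n choose 2) / pq_fact p q n) :: complex"]
  by (auto simp: pq_Exp_def sums_iff binomial_eq_0)

lemma pq_exp_series_0 [simp]: "pq_exp_series p q 0 = 1"
  using powser_sums_zero[of "\<lambda>n. of_real (p ^ (n choose 2) / pq_fact p q n) :: complex"]
  by (auto simp: pq_exp_series_def sums_iff binomial_eq_0)

lemma isCont_pq_Exp_0:
  assumes "0 < q" "q < p"
  shows "isCont (pq_Exp p q) 0"
  unfolding pq_Exp_def by (rule isCont_powser[OF summable_pq_Exp[OF assms, of 1]]) auto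

lemma isCont_pq_exp_series_0:
  assumes "0 < q" "q < p"
  shows "isCont (pq_exp_series p q) 0"
  unfolding pq_exp_series_def
  by (rule isCont_powser[OF summable_pq_exp[OF assms, of 1]]) (use assms in \<open>auto simp: field_simps\<close>)

text \<open>All coefficients are positive and the constant term is 1, so the real series is
  positive. Consequently, for positive \<open>s\<close> and \<open>t\<close>, the value of
  \<open>pq_exp\<close> at \<open>- p * t * s\<close> is a genuine one and never the 0 that division
  yields at a pole.\<close>

lemma pq_Exp_nonzero:
  assumes "0 < q" "q < p" "0 \<le> x"
  shows "pq_Exp p q (of_real x) \<noteq> 0"
proof -
  let ?f = "\<lambda>n. q ^ (n choose 2) / pq_fact p q n * x ^ n"
  have eq: "of_real (q ^ (n choose 2) / pq_fact p q n) * of_real x ^ n = (of_real (?f n) :: complex)" for n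
    by simp
  have S: "summable ?f"
    using summable_pq_Exp[OF assms(1,2), of "of_real x"] unfolding eq summable_of_real_iff .
  have "(\<Sum>n. ?f n) > 0"
    by (rule suminf_pos2[OF S, of 0])
      (use assms pq_fact_pos[OF assms(1,2)] in \<open>auto intro!: divide_nonneg_pos mult_nonneg_nonneg\<close>)
  moreover have "pq_Exp p q (of_real x) = of_real (\<Sum>n. ?f n)"
    unfolding pq_Exp_def eq by (rule suminf_of_real[OF S, symmetric])
  ultimately show ?thesis by (metis less_irrefl of_real_eq_0_iff)
qed

lemma tendsto_geometric_zero:
  fixes z :: complex
  assumes "0 < q" "q < p"
  shows "(\<lambda>n. of_real ((q / p) ^ n) * z) \<longlonglongrightarrow> 0"
proof -
  have "(\<lambda>n. (q / p) ^ n) \<longlonglongrightarrow> 0" using assms by (intro LIMSEQ_realpow_zero) auto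
  from tendsto_mult[OF tendsto_of_real[OF this] tendsto_const[of z]] show ?thesis by simp
qed

text \<open>The product is invariant under z \<open>\<mapsto>\<close> (q / p) z, hence equal to its value at 0.\<close>

lemma pq_exp_series_mult_pq_Exp:
  assumes "0 < q" "q < p" "norm z < p / (p - q)"
  shows "pq_exp_series p q z * pq_Exp p q (- z) = 1"
proof -
  define P where "P z = pq_exp_series p q z * pq_Exp p q (- z)" for z
  have inv: "P (of_real (q / p) * z) = P z" if "norm z < p / (p - q)" for z
    unfolding P_def pq_exp_series_functional[OF assms(1,2) that]
    using pq_Exp_functional[OF assms(1,2), of "- z"] by simp
  have "P (of_real ((q / p) ^ n) * z) = P z" for n
  proof (induction n)
    case (Suc n)
    \<comment> \<open>Each iterate stays in the disk, where the functional equation of the series is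
      available.\<close>
    have "norm (of_real ((q / p) ^ n) * z) \<le> norm z"
      using assms by (auto simp: norm_mult norm_power norm_divide intro!: mult_left_le_one_le power_le_one)
    hence "P (of_real (q / p) * (of_real ((q / p) ^ n) * z)) = P (of_real ((q / p) ^ n) * z)"
      using assms by (intro inv) linarith
    with Suc show ?case by (simp add: mult_ac)
  qed simp
  moreover have "(\<lambda>n. P (of_real ((q / p) ^ n) * z)) \<longlonglongrightarrow> P 0"
  proof (rule isCont_tendsto_compose[OF _ tendsto_geometric_zero[OF assms(1,2)]])
    show "isCont P 0"
      unfolding P_def using isCont_pq_exp_series_0[OF assms(1,2)] isCont_pq_Exp_0[OF assms(1,2)]
      by (intro continuous_mult isCont_o2[of 0 uminus "pq_Exp p q"]) auto
  qed
  ultimately have "P z = P 0" by (simp add: LIMSEQ_const_iff)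
  thus ?thesis by (simp add: P_def)
qed

text \<open>Reciprocity settles the inside of the disk and the definition the outside. From here on
  the case distinction in \<open>pq_exp\<close> disappears.\<close>

lemma pq_exp_eq:
  assumes "0 < q" "q < p"
  shows "pq_exp p q z = 1 / pq_Exp p q (- z)"
proof (cases "norm z < p / (p - q)")
  case True
  have "pq_exp p q z = pq_exp_series p q z" using True by (simp add: pq_exp_def pq_exp_series_def)
  with pq_exp_series_mult_pq_Exp[OF assms True] show ?thesis
    by (metis eq_divide_eq mult_zero_right zero_neq_one)
qed (simp add: pq_exp_def)

section \<open>Geometric nodes and linearity of the Laplace transform\<close>

lemma pq_node_pos:
  assumes "0 < q" "q < p"
  shows "pq_node p q j > 0"
  using assms by (simp add: pq_node_def)

lemma pq_node_diff_1:
  assumes "0 < q" "q < p"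
  shows "pq_node p q (j - 1) = pq_node p q j / (q / p)"
  using assms by (simp add: pq_node_def power_int_diff power_int_add field_simps)

lemma pq_node_of_nat:
  assumes "0 < q" "q < p"
  shows "pq_node p q (int n) = (q / p) ^ n / p"
  using assms by (simp add: pq_node_def power_int_add power_divide)

lemma pq_node_neg:
  assumes "0 < q" "q < p"
  shows "pq_node p q (- int n - 1) = (p / q) ^ n / q"
  using assms by (simp add: pq_node_def power_int_diff power_int_minus power_divide divide_simps)

text \<open>Couples convergence with the value, in the manner of \<open>sums\<close>, so that both
  pass through linear combinations together.\<close>

definition has_pq_laplace ::
    "real \<Rightarrow> real \<Rightarrow> (real \<Rightarrow> complex) \<Rightarrow> real \<Rightarrow> complex \<Rightarrow> bool" where
  "has_pq_laplace p q f s L \<longleftrightarrow> pq_laplace_converges p q f s \<and> pq_laplace p q f s = L"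

lemma has_pq_laplace_linear:
  assumes "has_pq_laplace p q f s L" "has_pq_laplace p q g s M"
  shows "has_pq_laplace p q (\<lambda>t. c * f t + d * g t) s (c * L + d * M)"
proof -
  have eq: "pq_term p q (pq_laplace_integrand p q (\<lambda>t. c * f t + d * g t) s) j
      = c * pq_term p q (pq_laplace_integrand p q f s) j
        + d * pq_term p q (pq_laplace_integrand p q g s) j" for j
    by (simp add: pq_term_def pq_laplace_integrand_def algebra_simps)
  have S: "(\<lambda>n. c * F n + d * G n) sums (c * suminf F + d * suminf G)"
    if "summable F" "summable G" for F G :: "nat \<Rightarrow> complex"
    using that by (intro sums_add sums_mult summable_sums)
  note defs = has_pq_laplace_def pq_laplace_def pq_laplace_converges_def pq_integrable_def
    pq_integral_def
  have L: "L = pq_laplace p q f s" "M = pq_laplace p q g s"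
    and conv: "pq_laplace_converges p q f s" "pq_laplace_converges p q g s"
    using assms by (auto simp: has_pq_laplace_def)
  show ?thesis
    using conv S unfolding L defs eq by (auto simp: sums_iff algebra_simps)
qed

section \<open>The transform of a big exponential by telescoping\<close>

text \<open>For large \<open>t\<close> the quotient of successive terms is close to
  \<open>\<beta> / B\<close>, of modulus below 1, so \<open>w\<close> is even summable by the ratio
  test. This controls the boundary term at infinity.\<close>

lemma tendsto_zero_ratio:
  fixes w :: "nat \<Rightarrow> complex" and t :: "nat \<Rightarrow> real" and \<beta> :: complex
  assumes t: "filterlim t at_top sequentially" and AB: "norm \<beta> < B"
    and step: "\<And>n. w (Suc n) * (1 + of_real (B * t n)) = w n * (1 + \<beta> * of_real (t n))"
  shows "w \<longlonglongrightarrow> 0"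
proof -
  have "0 < B" using AB norm_ge_zero[of \<beta>] by linarith
  hence "norm \<beta> / B < 1" using AB by simp
  then obtain c where c: "norm \<beta> / B < c" "c < 1" using dense by blast
  have "0 < c" using c(1) \<open>0 < B\<close> norm_ge_zero[of \<beta>]
    by (meson divide_nonneg_pos le_less_trans)
  have D: "c * B - norm \<beta> > 0" using c(1) \<open>0 < B\<close> by (simp add: field_simps)
  \<comment> \<open>The threshold comes from the target estimate: once
    \<open>t * (c * B - norm \<beta>)\<close> is at least 1, positivity of \<open>c\<close> gives
    \<open>1 + norm \<beta> * t \<le> c * (1 + B * t)\<close>.\<close>
  have "eventually (\<lambda>n. t n \<ge> 1 / (c * B - norm \<beta>)) sequentially"
    using t by (simp add: filterlim_at_top)
  then obtain N where N: "\<And>n. n \<ge> N \<Longrightarrow> t n \<ge> 1 / (c * B - norm \<beta>)"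
    by (auto simp: eventually_sequentially)
  have "summable w"
  proof (rule summable_ratio_test[OF c(2)])
    fix n assume "N \<le> n"
    from N[OF this] have le: "1 \<le> t n * (c * B - norm \<beta>)" using D by (simp add: field_simps)
    have tp: "t n > 0" using le D by (smt (verit) mult_nonpos_nonneg)
    have Bt: "0 < B * t n" using tp \<open>0 < B\<close> by simp
    have nB: "norm (1 + of_real (B * t n) :: complex) = 1 + B * t n"
      using Bt norm_of_real[of "1 + B * t n", where 'a = complex] by simp
    have "norm (w (Suc n)) * (1 + B * t n) = norm (w n) * norm (1 + \<beta> * of_real (t n))"
      using arg_cong[OF step[of n], of norm] unfolding norm_mult nB .
    also have "\<dots> \<le> norm (w n) * (1 + norm \<beta> * t n)"
      using norm_triangle_ineq[of 1 "\<beta> * of_real (t n)"] tp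
      by (intro mult_left_mono) (auto simp: norm_mult)
    also have "\<dots> \<le> norm (w n) * (c * (1 + B * t n))"
      using le \<open>0 < c\<close> by (intro mult_left_mono) (auto simp: algebra_simps)
    finally have "norm (w (Suc n)) * (1 + B * t n) \<le> (c * norm (w n)) * (1 + B * t n)"
      by (simp add: mult_ac)
    thus "norm (w (Suc n)) \<le> c * norm (w n)" using Bt by (simp add: mult_le_cancel_right)
  qed
  thus ?thesis by (rule summable_LIMSEQ_zero)
qed

text \<open>A complex \<open>b\<close> lets one result serve both trigonometric functions. The
  strict bound on \<open>norm b\<close> acts twice: it keeps \<open>q s - b\<close> away from 0 and
  makes the boundary term at infinity vanish.\<close>

lemma has_pq_laplace_pq_Exp:
  assumes "0 < q" "q < p" "0 < s" and b: "norm b < q * s"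
  shows "has_pq_laplace p q (\<lambda>t. pq_Exp p q (b * of_real t)) s (of_real q / (of_real (q * s) - b))"
proof -
  note pq = assms(1,2)
  define E where "E = pq_Exp p q"
  define r where "r = q / p"
  define W where "W t = E (b * of_real t) / E (of_real (q * s * t))" for t
  \<comment> \<open>\<open>K\<close> is the claimed value. It enters because
    \<open>W(t) - W(t / r)\<close> equals \<open>(p - q) / K\<close> times the term
    \<open>T j\<close> at the node \<open>t\<close>.\<close>
  define K where "K = of_real q / (of_real (q * s) - b)"
  define T where "T = pq_term p q (pq_laplace_integrand p q (\<lambda>t. E (b * of_real t)) s)"
  have r: "0 < r" "r < 1" "p * r = q" using assms by (auto simp: r_def)
  have qsb: "of_real (q * s) - b \<noteq> 0" 
  proof
    assume "of_real (q * s) - b = 0"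
    hence "norm b = norm (of_real (q * s) :: complex)" by simp
    thus False using b assms unfolding norm_of_real by simp
  qed
  have fe: "E z = (1 + of_real (1 - r) * z) * E (of_real r * z)" for z
    unfolding E_def r_def by (rule pq_Exp_functional[OF pq])
  have nz: "E (of_real x) \<noteq> 0" if "0 \<le> x" for x
    unfolding E_def by (rule pq_Exp_nonzero[OF pq that])
  have Eps: "E (of_real (p * s * t)) = of_real (1 + (1 - r) * (p * s * t)) * E (of_real (q * s * t))" for t
  proof -
    have "of_real r * of_real (p * s * t) = (of_real (q * s * t) :: complex)"
      unfolding r(3)[symmetric] by simp
    thus ?thesis using fe[of "of_real (p * s * t)"]
      by (simp only: of_real_add of_real_1 of_real_mult[of "1 - r"])
  qed
  have Eb: "E (b * of_real (t / r)) = (1 + of_real (1 - r) * (b * of_real (t / r))) * E (b * of_real t)" for t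
    using fe[of "b * of_real (t / r)"] r by simp
  have qr: "q * s * (t / r) = p * s * t" for t
    using r by (simp add: field_simps flip: r(3))
  \<comment> \<open>Both values of \<open>W\<close> are brought to the common quotient
    \<open>E(b t) / E(p s t)\<close>, which is the integrand. For \<open>W t\<close> the fact
    \<open>Eps\<close> trades the denominator; for \<open>W (t / r)\<close> in \<open>W2\<close>,
    \<open>Eb\<close> expands the numerator and \<open>qr\<close> identifies the
    denominator.\<close>
  have W1: "W t = of_real (1 + (1 - r) * (p * s * t)) * (E (b * of_real t) / E (of_real (p * s * t)))"
    if "0 < t" for t
  proof -
    have "1 + (1 - r) * (p * s * t) > 0" using that r assms by (intro add_pos_nonneg) auto
    hence "of_real (1 + (1 - r) * (p * s * t)) \<noteq> (0 :: complex)" by (metis less_irrefl of_real_eq_0_iff)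
    thus ?thesis unfolding W_def Eps by simp
  qed
  have W2: "W (t / r) = (1 + of_real (1 - r) * (b * of_real (t / r)))
              * (E (b * of_real t) / E (of_real (p * s * t)))" for t
    unfolding W_def Eb qr by simp
  have T: "of_real (p - q) * T j = K * (W (pq_node p q j) - W (pq_node p q (j - 1)))" for j
  proof -
    define t where "t = pq_node p q j"
    have t: "0 < t" unfolding t_def by (rule pq_node_pos[OF pq])
    define G where "G = E (b * of_real t) / E (of_real (p * s * t))"
    have Tt: "T j = of_real t * G"
      unfolding G_def T_def pq_term_def pq_laplace_integrand_def t_def[symmetric] pq_exp_eq[OF pq]
      by (simp add: E_def mult_ac)
    have "W t - W (t / r) = of_real t * (of_real (1 - r) * (of_real (p * s) - b / of_real r)) * G"
      unfolding W1[OF t] W2 G_def[symmetric] by (simp add: algebra_simps)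
    also have "\<dots> = (of_real (1 - r) * (of_real (p * s) - b / of_real r)) * T j"
      unfolding Tt by simp
    also have "of_real (1 - r) * (of_real (p * s) - b / of_real r)
        = of_real (p - q) * (of_real (q * s) - b) / of_real q"
      using assms by (simp add: r_def field_simps)
    finally show ?thesis
      unfolding pq_node_diff_1[OF pq] r_def[symmetric] t_def[symmetric] K_def
      using qsb assms by simp
  qed
  \<comment> \<open>The index \<open>int n - 1\<close> makes the half \<open>j \<ge> 0\<close>
    telescope from the node of index -1, the point it shares with the other half. Numerator and
    denominator of \<open>W\<close> both tend to \<open>E(0) = 1\<close>.\<close>
  have lim1: "(\<lambda>n. W (pq_node p q (int n - 1))) \<longlonglongrightarrow> 1"
  proof (rule LIMSEQ_imp_Suc)
    have "(\<lambda>n. E (c * of_real (pq_node p q (int n)))) \<longlonglongrightarrow> E 0" for c :: complex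
    proof (rule isCont_tendsto_compose[where g = E])
      show "isCont E 0" unfolding E_def by (rule isCont_pq_Exp_0[OF pq])
      show "(\<lambda>n. c * of_real (pq_node p q (int n))) \<longlonglongrightarrow> 0"
        using tendsto_geometric_zero[OF pq, of "c / of_real p"]
        by (simp add: pq_node_of_nat[OF pq] mult_ac)
    qed
    from tendsto_divide[OF this[of b] this[of "of_real (q * s)"]]
    show "(\<lambda>n. W (pq_node p q (int (Suc n) - 1))) \<longlonglongrightarrow> 1" by (simp add: W_def E_def)
  qed
  \<comment> \<open>Outward along the nodes, \<open>W1\<close> and \<open>W2\<close> give
    \<open>W(t / r) (1 + B t) = W(t) (1 + \<beta> t)\<close> with \<open>B = (1 - r) p s\<close> and
    \<open>\<beta> = (1 - r) b / r\<close>. Since \<open>p r = q\<close>, the condition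
    \<open>norm \<beta> < B\<close> amounts to \<open>norm b < q s\<close>.\<close>
  have lim0: "(\<lambda>n. W (pq_node p q (- int n - 1))) \<longlonglongrightarrow> 0"
  proof (rule tendsto_zero_ratio)
    have "filterlim (\<lambda>n. (p / q) ^ n * (1 / q)) at_top sequentially"
      using assms
      by (intro filterlim_at_top_mult_tendsto_pos[OF tendsto_const]
            filterlim_at_infinity_imp_filterlim_at_top filterlim_realpow_sequentially_gt1) auto
    thus "filterlim (\<lambda>n. pq_node p q (- int n - 1)) at_top sequentially"
      by (simp add: pq_node_neg[OF pq])
    have "norm (of_real (1 - r) * (b / of_real r)) = (1 - r) * (norm b / r)"
      using r by (simp only: norm_mult norm_divide norm_of_real)
    also have "\<dots> < (1 - r) * (p * s)"
      using r b by (intro mult_strict_left_mono) (auto simp: field_simps simp flip: r(3))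
    finally show "norm (of_real (1 - r) * (b / of_real r)) < (1 - r) * (p * s)" .
    fix n
    define t where "t = pq_node p q (- int n - 1)"
    have t: "0 < t" unfolding t_def by (rule pq_node_pos[OF pq])
    have "pq_node p q (- int (Suc n) - 1) = t / r"
      using pq_node_diff_1[OF pq, of "- int n - 1"] by (simp add: t_def r_def algebra_simps)
    thus "W (pq_node p q (- int (Suc n) - 1)) * (1 + of_real ((1 - r) * (p * s) * pq_node p q (- int n - 1)))
        = W (pq_node p q (- int n - 1)) *
          (1 + of_real (1 - r) * (b / of_real r) * of_real (pq_node p q (- int n - 1)))"
      unfolding t_def[symmetric] by (simp add: W1[OF t] W2 mult_ac)
  qed
  \<comment> \<open>The two halves leave \<open>K (1 - W)\<close> and \<open>K W\<close> with
    \<open>W\<close> taken at the node of index -1; this shared boundary value cancels in the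
    total.\<close>
  have "(\<lambda>n. K * (W (pq_node p q (int (Suc n) - 1)) - W (pq_node p q (int n - 1))))
          sums (K * (1 - W (pq_node p q (int 0 - 1))))"
    by (intro sums_mult telescope_sums lim1)
  hence A: "(\<lambda>n. of_real (p - q) * T (int n)) sums (K * (1 - W (pq_node p q (- 1))))"
    unfolding T by simp
  have "(\<lambda>n. K * (W (pq_node p q (- int n - 1)) - W (pq_node p q (- int (Suc n) - 1))))
          sums (K * (W (pq_node p q (- int 0 - 1)) - 0))"
    by (intro sums_mult telescope_sums' lim0)
  moreover have "- int (Suc n) - 1 = - int n - 1 - 1" for n by simp
  ultimately have B: "(\<lambda>n. of_real (p - q) * T (- int n - 1)) sums (K * W (pq_node p q (- 1)))"
    unfolding T by simp
  have pq0: "of_real (p - q) \<noteq> (0 :: complex)" using assms by simp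
  from A B have SA: "summable (\<lambda>n. T (int n))" and SB: "summable (\<lambda>n. T (- int n - 1))"
    using pq0 summable_cmult_iff[of "of_real (p - q) :: complex"] by (metis sums_summable)+
  have "of_real (p - q) * ((\<Sum>n. T (int n)) + (\<Sum>n. T (- int n - 1))) = K"
    unfolding distrib_left suminf_mult[OF SA, symmetric] suminf_mult[OF SB, symmetric]
      sums_unique[OF A, symmetric] sums_unique[OF B, symmetric]
    by (simp add: algebra_simps)
  with SA SB show ?thesis
    unfolding has_pq_laplace_def pq_laplace_def pq_laplace_converges_def pq_integrable_def
      pq_integral_def T_def E_def K_def by simp
qed

section \<open>Cosine and sine as combinations of exponentials\<close>

text \<open>The average of \<open>E(i z)\<close> and \<open>E(- i z)\<close> is the even part of the
  series. Its vanishing odd terms are dropped by reindexing along the strictly monotone map from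
  \<open>n\<close> to \<open>2 * n\<close>.\<close>

lemma pq_Cos_eq:
  assumes "0 < q" "q < p"
  shows "pq_Cos p q z = 1 / 2 * pq_Exp p q (\<i> * z) + 1 / 2 * pq_Exp p q (- \<i> * z)"
proof -
  let ?c = "\<lambda>n. of_real (q ^ (n choose 2) / pq_fact p q n) :: complex"
  let ?f = "\<lambda>n. 1 / 2 * (?c n * (\<i> * z) ^ n) + 1 / 2 * (?c n * (- \<i> * z) ^ n)"
  have "?f sums (1 / 2 * pq_Exp p q (\<i> * z) + 1 / 2 * pq_Exp p q (- \<i> * z))"
    unfolding pq_Exp_def by (intro sums_add sums_mult summable_sums summable_pq_Exp assms)
  moreover have "?f n = 0" if "n \<notin> range (\<lambda>n. 2 * n)" for n
  proof -
    have "odd n" using that by (auto elim!: evenE)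
    thus ?thesis by simp
  qed
  ultimately have "(\<lambda>n. ?f (2 * n)) sums (1 / 2 * pq_Exp p q (\<i> * z) + 1 / 2 * pq_Exp p q (- \<i> * z))"
    by (subst sums_mono_reindex) (auto simp: strict_mono_def)
  moreover have "?f (2 * n) = of_real ((-1) ^ n * q ^ ((2 * n) choose 2) / pq_fact p q (2 * n)) * z ^ (2 * n)" for n
    by (simp add: power_mult_distrib power_mult power_minus[of "z\<^sup>2"])
  ultimately show ?thesis unfolding pq_Cos_def by (simp only: sums_iff)
qed

text \<open>The odd part, extracted likewise; the weights \<open>- \<i> / 2\<close> and
  \<open>\<i> / 2\<close> are \<open>1 / (2 i)\<close> and its negative, as in Euler's
  formula.\<close>

lemma pq_Sin_eq:
  assumes "0 < q" "q < p"
  shows "pq_Sin p q z = - \<i> / 2 * pq_Exp p q (\<i> * z) + \<i> / 2 * pq_Exp p q (- \<i> * z)"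
proof -
  let ?c = "\<lambda>n. of_real (q ^ (n choose 2) / pq_fact p q n) :: complex"
  let ?f = "\<lambda>n. - \<i> / 2 * (?c n * (\<i> * z) ^ n) + \<i> / 2 * (?c n * (- \<i> * z) ^ n)"
  have "?f sums (- \<i> / 2 * pq_Exp p q (\<i> * z) + \<i> / 2 * pq_Exp p q (- \<i> * z))"
    unfolding pq_Exp_def by (intro sums_add sums_mult summable_sums summable_pq_Exp assms)
  moreover have "?f n = 0" if "n \<notin> range (\<lambda>n. 2 * n + 1)" for n
  proof -
    have "even n" using that by (metis oddE rangeI)
    thus ?thesis by simp
  qed
  ultimately have "(\<lambda>n. ?f (2 * n + 1)) sums (- \<i> / 2 * pq_Exp p q (\<i> * z) + \<i> / 2 * pq_Exp p q (- \<i> * z))"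
    by (subst sums_mono_reindex) (auto simp: strict_mono_def)
  moreover have "?f (2 * n + 1)
      = of_real ((-1) ^ n * q ^ ((2 * n + 1) choose 2) / pq_fact p q (2 * n + 1)) * z ^ (2 * n + 1)" for n
    by (simp add: power_mult_distrib power_mult power_minus[of "z\<^sup>2"])
  ultimately show ?thesis unfolding pq_Sin_def by (simp only: sums_iff)
qed

theorem corollary3p14:
  fixes p q a s :: real
  assumes "0 < q" and "q < p"
    and "0 < s" and "\<bar>a / q\<bar> < s"
  shows "pq_laplace_converges p q (\<lambda>t. pq_Cos p q (of_real (a * t))) s
       \<and> pq_laplace p q (\<lambda>t. pq_Cos p q (of_real (a * t))) s
           = of_real (q\<^sup>2 * s / ((q * s)\<^sup>2 + a\<^sup>2))
       \<and> pq_laplace_converges p q (\<lambda>t. pq_Sin p q (of_real (a * t))) s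
       \<and> pq_laplace p q (\<lambda>t. pq_Sin p q (of_real (a * t))) s
           = of_real (q * a / ((q * s)\<^sup>2 + a\<^sup>2))"
proof -
  have a: "\<bar>a\<bar> < q * s" using assms by (simp add: field_simps)
  have L: "has_pq_laplace p q (\<lambda>t. pq_Exp p q (\<i> * of_real (a * t))) s
            (of_real q / (of_real (q * s) - \<i> * of_real a))"
          "has_pq_laplace p q (\<lambda>t. pq_Exp p q (- \<i> * of_real (a * t))) s
            (of_real q / (of_real (q * s) - - \<i> * of_real a))"
    using has_pq_laplace_pq_Exp[OF assms(1-3), of "\<i> * of_real a"]
      has_pq_laplace_pq_Exp[OF assms(1-3), of "- \<i> * of_real a"] a
    by (simp_all add: norm_mult mult_ac)
  have "q * s \<noteq> 0" using assms by simp
  hence nz: "(q * s)\<^sup>2 + a\<^sup>2 \<noteq> 0" by (simp add: sum_power2_eq_zero_iff)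
  \<comment> \<open>Multiplying by the conjugate denominators shows the two transforms to be complex
    conjugates. Their real part is the value for the cosine, and the imaginary part of the first is
    the value for the sine.\<close>
  have V: "of_real q / (of_real (q * s) - \<i> * of_real a)
            = Complex (q * (q * s) / ((q * s)\<^sup>2 + a\<^sup>2)) (q * a / ((q * s)\<^sup>2 + a\<^sup>2))"
          "of_real q / (of_real (q * s) - - \<i> * of_real a)
            = Complex (q * (q * s) / ((q * s)\<^sup>2 + a\<^sup>2)) (- (q * a / ((q * s)\<^sup>2 + a\<^sup>2)))"
    by (simp_all add: complex_eq_iff Re_divide Im_divide)
  \<comment> \<open>The weights of \<open>pq_Cos_eq\<close> and \<open>pq_Sin_eq\<close> extract
    exactly these two parts from a conjugate pair.\<close>
  have C: "1 / 2 * Complex x y + 1 / 2 * Complex x (- y) = of_real x"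
    "- \<i> / 2 * Complex x y + \<i> / 2 * Complex x (- y) = of_real y" for x y
    by (simp_all add: complex_eq_iff)
  show ?thesis
    using has_pq_laplace_linear[OF L, of "1 / 2" "1 / 2"]
      has_pq_laplace_linear[OF L, of "- \<i> / 2" "\<i> / 2"]
    unfolding pq_Cos_eq[OF assms(1,2), symmetric] pq_Sin_eq[OF assms(1,2), symmetric] V C
    unfolding has_pq_laplace_def by (simp add: power2_eq_square)
qed

end
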